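(* Let $n\ge 2$, let $I\subset\mathbb{R}$ be an open interval, and let $a,b\in\Delta_n$ with $a\preceq b$. Let $S\subseteq\{0,1,\ldots,n-1\}$ denote the set of all integers $k\in\{0,1,\ldots,n-1\}$ with $E_k(a)<E_k(b)$. Let $f\in C^n(I)$ be a real-valued function such that $$(-1)^{n+k}\,(x^k f'(x))^{(n-1)}\le 0\quad\text{for all }x\in I\text{ and all }k\in S,$$ where $(\cdot)^{(n-1)}$ denotes the $(n-1)$-st derivative with respect to $x$. Then $$f(a_1)+f(a_2)+\ldots+f(a_n)\le f(b_1)+f(b_2)+\ldots+f(b_n).$$
   Context: For $n\ge2$ and $k\in\{0,1,\ldots,n-1\}$, $E_k(y_1,\ldots,y_n)=\sum_{1\le i_1<\ldots<i_{n-k}\le n} y_{i_1}y_{i_2}\cdots y_{i_{n-k}}$ is the elementary symmetric polynomial of degree $n-k$ (so $E_0=y_1\cdots y_n$ and $E_{n-1}=y_1+\ldots+y_n$). For an open interval $I\subset\mathbb{R}$, $\Delta_n=\{y=(y_1,\ldots,y_n)\in I^n : y_1\le y_2\le\ldots\le y_n\}$. For $a,b\in\Delta_n$, one writes $a\preceq b$ ("$b$ dominates $a$") if there exists a map $y\colon[0,1]\to\Delta_n$ that is piecewise differentiable (i.e. continuous on $[0,1]$ and differentiable at all but at most countably many points), with $y(0)=a$, $y(1)=b$, with $y_i(t)\ne y_j(t)$ for $i\ne j$ for all but at most countably many $t\in[0,1]$, and such that the functions $A_k(t)=E_k(y(t))$, $k\in\{0,1,\ldots,n-1\}$, are all non-decreasing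 on $[0,1]$. *)

theory Defs
  imports "HOL-Analysis.Analysis"
begin

text \<open>
  An \<open>n\<close>-tuple of reals is a function \<open>nat \<Rightarrow> real\<close> with indices \<open>1, \<dots>, n\<close>. Tuples in \<open>Delta n I\<close>
  are extensional (\<open>undefined\<close> outside \<open>{1..n}\<close>), so that equality of functions is equality of tuples.
\<close>

definition esym :: "nat \<Rightarrow> nat \<Rightarrow> (nat \<Rightarrow> real) \<Rightarrow> real" where
  "esym n k y = (\<Sum>J | J \<subseteq> {1..n} \<and> card J = n - k. \<Prod>i\<in>J. y i)"

definition Delta :: "nat \<Rightarrow> real set \<Rightarrow> (nat \<Rightarrow> real) set" where
  "Delta n I = {y \<in> {1..n} \<rightarrow>\<^sub>E I. mono_on {1..n} y}"

text \<open>
  Not the library's \<^const>\<open>piecewise_differentiable_on\<close>, which allows only finitely many exceptional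
  points.
\<close>

definition piecewise_diff :: "nat \<Rightarrow> (real \<Rightarrow> nat \<Rightarrow> real) \<Rightarrow> bool" where
  "piecewise_diff n y \<longleftrightarrow>
     (\<forall>i\<in>{1..n}. continuous_on {0..1} (\<lambda>t. y t i)) \<and>
     countable {t \<in> {0..1}. \<not> (\<forall>i\<in>{1..n}. (\<lambda>s. y s i) differentiable (at t within {0..1}))}"

definition dominated :: "nat \<Rightarrow> real set \<Rightarrow> (nat \<Rightarrow> real) \<Rightarrow> (nat \<Rightarrow> real) \<Rightarrow> bool" where
  "dominated n I a b \<longleftrightarrow>
     (\<exists>y :: real \<Rightarrow> nat \<Rightarrow> real.
        (\<forall>t\<in>{0..1}. y t \<in> Delta n I) \<and> piecewise_diff n y \<and> y 0 = a \<and> y 1 = b \<and>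
        countable {t \<in> {0..1}. \<not> (\<forall>i\<in>{1..n}. \<forall>j\<in>{1..n}. i \<noteq> j \<longrightarrow> y t i \<noteq> y t j)} \<and>
        (\<forall>k\<in>{0..n-1}. mono_on {0..1} (\<lambda>t. esym n k (y t))))"

text \<open>
  For open \<open>I\<close> only: derivatives are two-sided, so \<^const>\<open>deriv\<close> at a point of \<open>I\<close> depends only on the
  values of \<open>f\<close> on \<open>I\<close>.
\<close>

definition Ck_on :: "nat \<Rightarrow> (real \<Rightarrow> real) \<Rightarrow> real set \<Rightarrow> bool" where
  "Ck_on m f I \<longleftrightarrow>
     (\<forall>j<m. \<forall>x\<in>I. (deriv ^^ j) f field_differentiable (at x)) \<and>
     continuous_on I ((deriv ^^ m) f)"

end

theory Submission
  imports Defs "HOL-Computational_Algebra.Polynomial"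
begin

text \<open>
  Vieta: the \<open>y i\<close> are the roots of \<open>x ^ n + (\<Sum>k<n. (-1) ^ (n + k) * A k * x ^ k)\<close>. Differentiating
  this in \<open>t\<close> expresses the velocity of each root by the derivatives \<open>A' k\<close>, and turns the derivative
  of \<open>\<Sum>i. f (y i)\<close> into the sum over \<open>k\<close> of \<open>- (-1) ^ (n + k) * A' k\<close> times the divided difference of
  \<open>x ^ k * f' x\<close> at the \<open>n\<close> roots. The mean value theorem for divided differences gives the sign for
  \<open>k \<in> S\<close>; for \<open>k \<notin> S\<close> the monotone function \<open>A k\<close> has equal end values, so \<open>A' k = 0\<close>. Countably many
  exceptional \<open>t\<close> do no harm, since the sum is continuous in \<open>t\<close>.
\<close>

section \<open>Rolle's theorem and the mean value theorem for divided differences\<close>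

text \<open>Rolle's theorem puts a zero of \<open>F 1\<close> strictly between any two consecutive
  zeros of \<open>F 0\<close>. These new zeros are again increasing and one fewer in number, so
  induction on \<open>m\<close> applies to the shifted family.\<close>

lemma iterated_Rolle:
  fixes F :: "nat \<Rightarrow> real \<Rightarrow> real" and z :: "nat \<Rightarrow> real"
  assumes "is_interval I"
    and "\<And>j x. j < m \<Longrightarrow> x \<in> I \<Longrightarrow> (F j has_real_derivative F (Suc j) x) (at x)"
    and "\<And>i. i \<le> m \<Longrightarrow> z i \<in> I \<and> F 0 (z i) = 0"
    and "\<And>i. i < m \<Longrightarrow> z i < z (Suc i)"
  shows "\<exists>\<xi>\<in>I. F m \<xi> = 0"
  using assms(2-)
proof (induction m arbitrary: F z)
  case 0
  then show ?case by auto
next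
  case (Suc m)
  have "\<exists>w. z i < w \<and> w < z (Suc i) \<and> F (Suc 0) w = 0" if i: "i \<le> m" for i
  proof -
    have sub: "{z i..z (Suc i)} \<subseteq> I"
      using Suc.prems(2)[of i] Suc.prems(2)[of "Suc i"] i \<open>is_interval I\<close>
      by (auto simp: is_interval_1)
    have der: "(F 0 has_real_derivative F (Suc 0) x) (at x)" if "x \<in> {z i..z (Suc i)}" for x
      using Suc.prems(1)[of 0 x] that sub by auto
    have "\<exists>w. z i < w \<and> w < z (Suc i) \<and> (\<lambda>v. F (Suc 0) w * v) = (\<lambda>v. 0)"
    proof (rule Rolle_deriv)
      show "continuous_on {z i..z (Suc i)} (F 0)"
        using der DERIV_isCont by (blast intro: continuous_at_imp_continuous_on)
    qed (use der Suc.prems(2)[of i] Suc.prems(2)[of "Suc i"] Suc.prems(3)[of i] i in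
        \<open>auto simp: has_field_derivative_def\<close>)
    then show ?thesis by (metis mult_1_right)
  qed
  then obtain w where w: "\<And>i. i \<le> m \<Longrightarrow> z i < w i \<and> w i < z (Suc i) \<and> F (Suc 0) (w i) = 0"
    by metis
  have "\<exists>\<xi>\<in>I. F (Suc m) \<xi> = 0"
  proof (rule Suc.IH[of "\<lambda>j. F (Suc j)" w])
    show "w i \<in> I \<and> F (Suc 0) (w i) = 0" if "i \<le> m" for i
      using w[OF that] Suc.prems(2)[of i] Suc.prems(2)[of "Suc i"] that
        mem_is_interval_1_I[OF \<open>is_interval I\<close>, of "z i" "z (Suc i)" "w i"] by auto
    show "w i < w (Suc i)" if "i < m" for i
      using w[of i] w[of "Suc i"] that by auto
  qed (use Suc.prems(1) in auto)
  then show ?case .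
qed

lemma poly_funpow_pderiv_const:
  fixes p :: "'a :: {comm_semiring_1, semiring_no_zero_divisors, semiring_char_0} poly"
  assumes "degree p \<le> m"
  shows "poly ((pderiv ^^ m) p) x = fact m * coeff p m"
proof -
  have "(pderiv ^^ m) p = [:fact m * coeff p m:]"
    using assms by (intro poly_eqI)
      (auto simp: coeff_higher_pderiv coeff_pCons pochhammer_fact coeff_eq_0 split: nat.split)
  then show ?thesis by simp
qed

text \<open>\<open>L\<close> is the Lagrange interpolant of \<open>G 0\<close> at the nodes: each
  \<open>q i\<close> is monic of degree \<open>m\<close>, so the coefficient of \<open>L\<close> at
  \<open>m\<close> is the divided difference. \<open>G 0 - L\<close> vanishes at
  \<open>Suc m\<close> points, hence its \<open>m\<close>-th derivative vanishes somewhere in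
  \<open>I\<close>, and the \<open>m\<close>-th derivative of \<open>L\<close> is the constant
  \<open>fact m * coeff L m\<close>.\<close>

lemma divided_difference_mvt:
  fixes G :: "nat \<Rightarrow> real \<Rightarrow> real" and y :: "'a \<Rightarrow> real"
  assumes I: "is_interval I"
    and der: "\<And>j x. j < m \<Longrightarrow> x \<in> I \<Longrightarrow> (G j has_real_derivative G (Suc j) x) (at x)"
    and J: "card J = Suc m" "inj_on y J" "y ` J \<subseteq> I"
  shows "\<exists>\<xi>\<in>I. fact m * (\<Sum>i\<in>J. G 0 (y i) / (\<Prod>j\<in>J - {i}. y i - y j)) = G m \<xi>"
proof -
  have fin: "finite J" using J(1) by (intro card_ge_0_finite) simp
  define q where "q i = (\<Prod>j\<in>J - {i}. [:- y j, 1:])" for i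
  define c where "c i = G 0 (y i) / (\<Prod>j\<in>J - {i}. y i - y j)" for i
  define L where "L = (\<Sum>i\<in>J. smult (c i) (q i))"
  have deg: "degree (q i) = m" if "i \<in> J" for i
    using that fin J(1) by (simp add: q_def degree_prod_eq_sum_degree)
  have "lead_coeff (q i) = 1" for i
    by (simp add: q_def lead_coeff_prod)
  with deg have coeff_q: "coeff (q i) m = 1" if "i \<in> J" for i
    using that by metis
  have degL: "degree L \<le> m"
    unfolding L_def using deg by (intro degree_sum_le fin) (auto intro: order.trans[OF degree_smult_le])
  have coeffL: "coeff L m = sum c J"
    using coeff_q by (simp add: L_def coeff_sum)
  have interp: "poly L (y i) = G 0 (y i)" if i: "i \<in> J" for i
  proof -
    have "poly (q k) (y i) = 0" if "k \<in> J - {i}" for k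
      using that i fin by (auto simp: q_def poly_prod)
    then have "poly L (y i) = c i * poly (q i) (y i)"
      using i fin by (simp add: L_def poly_sum sum.remove[of J i])
    moreover have "poly (q i) (y i) = (\<Prod>j\<in>J - {i}. y i - y j)"
      by (simp add: q_def poly_prod)
    moreover have "(\<Prod>j\<in>J - {i}. y i - y j) \<noteq> 0"
      using fin i J(2) by (auto simp: inj_on_def)
    ultimately show ?thesis by (simp add: c_def)
  qed
  \<comment> \<open>Iterated Rolle wants the zeros in increasing order, whereas the nodes come
    indexed by an arbitrary set.\<close>
  define z where "z i = sorted_list_of_set (y ` J) ! i" for i
  have len: "length (sorted_list_of_set (y ` J)) = Suc m"
    using J by (simp add: card_image)
  have zJ: "z i \<in> y ` J" if "i \<le> m" for i
    using nth_mem[of i "sorted_list_of_set (y ` J)"] that len fin by (simp add: z_def)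
  have "\<exists>\<xi>\<in>I. G m \<xi> - poly ((pderiv ^^ m) L) \<xi> = 0"
  proof (rule iterated_Rolle[where z = z and F = "\<lambda>j x. G j x - poly ((pderiv ^^ j) L) x", OF I])
    show "((\<lambda>x. G j x - poly ((pderiv ^^ j) L) x) has_real_derivative
        G (Suc j) x - poly ((pderiv ^^ Suc j) L) x) (at x)" if "j < m" "x \<in> I" for j x
      using der[OF that] by (auto intro!: derivative_eq_intros poly_DERIV)
    show "z i \<in> I \<and> G 0 (z i) - poly ((pderiv ^^ 0) L) (z i) = 0" if "i \<le> m" for i
      using zJ[OF that] J(3) interp by auto
    show "z i < z (Suc i)" if "i < m" for i
      unfolding z_def using that len
      by (intro sorted_wrt_nth_less[OF strict_sorted_list_of_set]) auto
  qed
  then show ?thesis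
    by (auto simp: poly_funpow_pderiv_const[OF degL] coeffL c_def intro!: bexI)
qed

section \<open>Differentiability up to a given order\<close>

text \<open>The differentiability half of \<open>Ck_on\<close>. As \<open>deriv\<close> is total, it
  has to be shown separately that the iterates of \<open>deriv\<close> on
  \<open>x ^ k * deriv f x\<close> are genuine derivatives, which the mean value theorem
  requires.\<close>

definition diff_upto :: "nat \<Rightarrow> (real \<Rightarrow> real) \<Rightarrow> real set \<Rightarrow> bool" where
  "diff_upto m g I \<longleftrightarrow> (\<forall>j<m. \<forall>x\<in>I. (deriv ^^ j) g field_differentiable (at x))"

lemma diff_upto_0: "diff_upto 0 g I"
  by (simp add: diff_upto_def)

text \<open>Peels off the innermost derivative, so that inductions on \<open>m\<close> can pass from
  \<open>g\<close> to \<open>deriv g\<close>.\<close>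

lemma diff_upto_Suc:
  "diff_upto (Suc m) g I \<longleftrightarrow> (\<forall>x\<in>I. g field_differentiable (at x)) \<and> diff_upto m (deriv g) I"
  unfolding diff_upto_def by (auto simp: less_Suc_eq_0_disj funpow_swap1 funpow_Suc_right simp del: funpow.simps)

lemma diff_upto_mono: "diff_upto m g I \<Longrightarrow> k \<le> m \<Longrightarrow> diff_upto k g I"
  by (auto simp: diff_upto_def)

text \<open>Functions equal on an open set have equal derivatives there. This allows
  \<open>deriv\<close> of a sum or product to be replaced by its formula, which is known on
  \<open>I\<close> only.\<close>

lemma diff_upto_cong:
  assumes "open I" "\<And>x. x \<in> I \<Longrightarrow> g x = h x" "diff_upto m g I"
  shows "diff_upto m h I"
  using assms(2,3)
proof (induction m arbitrary: g h)
  case (Suc m)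
  have "(h has_field_derivative deriv g x) (at x)" if "x \<in> I" for x
    using Suc.prems that \<open>open I\<close>
    by (intro has_field_derivative_transform_within_open[of g _ x I h])
      (auto simp: diff_upto_Suc field_differentiable_derivI)
  then show ?case
    using Suc.prems Suc.IH[of "deriv g" "deriv h"]
    by (simp add: diff_upto_Suc) (metis DERIV_imp_deriv field_differentiable_def)
qed (simp add: diff_upto_0)

lemma diff_upto_add:
  assumes "open I" "diff_upto m g I" "diff_upto m h I"
  shows "diff_upto m (\<lambda>x. g x + h x) I"
  using assms(2,3)
proof (induction m arbitrary: g h)
  case (Suc m)
  have "diff_upto m (deriv (\<lambda>x. g x + h x)) I"
    by (rule diff_upto_cong[OF \<open>open I\<close> _ Suc.IH[of "deriv g" "deriv h"]])
      (use Suc.prems in \<open>auto simp: diff_upto_Suc\<close>)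
  then show ?case
    using Suc.prems by (auto simp: diff_upto_Suc intro!: field_differentiable_add)
qed (simp add: diff_upto_0)

lemma diff_upto_mult:
  assumes "open I" "diff_upto m g I" "diff_upto m h I"
  shows "diff_upto m (\<lambda>x. g x * h x) I"
  using assms(2,3)
proof (induction m arbitrary: g h)
  case (Suc m)
  have low: "diff_upto m g I" "diff_upto m h I"
    using Suc.prems diff_upto_mono[of "Suc m" _ I m] by auto
  \<comment> \<open>The product rule turns the derivative into products of functions that are
    differentiable \<open>m\<close> times, to which the induction hypothesis applies.\<close>
  have "diff_upto m (\<lambda>x. g x * deriv h x + deriv g x * h x) I"
    using low Suc.prems by (intro diff_upto_add Suc.IH \<open>open I\<close>) (auto simp: diff_upto_Suc)
  then have "diff_upto m (deriv (\<lambda>x. g x * h x)) I"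
    by (rule diff_upto_cong[OF \<open>open I\<close>, rotated]) (use Suc.prems in \<open>auto simp: diff_upto_Suc\<close>)
  then show ?case
    using Suc.prems by (auto simp: diff_upto_Suc intro!: field_differentiable_mult)
qed (simp add: diff_upto_0)

lemma diff_upto_const: "diff_upto m (\<lambda>x. c) I"
  by (induction m arbitrary: c) (simp_all add: diff_upto_0 diff_upto_Suc)

lemma diff_upto_ident: "diff_upto m (\<lambda>x. x) I"
  by (cases m) (simp_all add: diff_upto_0 diff_upto_Suc diff_upto_const)

lemma diff_upto_power: "open I \<Longrightarrow> diff_upto m (\<lambda>x. x ^ k) I"
  by (induction k) (simp_all add: diff_upto_const diff_upto_ident diff_upto_mult)

section \<open>Vieta's formula\<close>

lemma prod_diff_esym:
  "(\<Prod>i=1..n. x - y i) = x ^ n + (\<Sum>k<n. (-1) ^ (n + k) * esym n k y * x ^ k)"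
proof -
  have "(\<Prod>i=1..n. x - y i) = (\<Sum>X\<in>Pow {1..n}. (-1) ^ card X * prod y X * x ^ (n - card X))"
    unfolding prod_diff_conv_sum[OF finite_atLeastAtMost]
    by (intro sum.cong) (auto simp: card_Diff_subset finite_subset[of _ "{1..n}"])
  also have "\<dots> = (\<Sum>k\<le>n. \<Sum>X | X \<in> Pow {1..n} \<and> n - card X = k.
      (-1) ^ card X * prod y X * x ^ (n - card X))"
    by (rule sum.group[symmetric]) auto
  also have "\<dots> = (\<Sum>k\<le>n. (-1) ^ (n + k) * esym n k y * x ^ k)"
  proof (rule sum.cong)
    fix k assume "k \<in> {..n}"
    \<comment> \<open>Subtraction is truncated: only with \<open>card X \<le> n\<close> does
      \<open>n - card X = k\<close> amount to \<open>card X = n - k\<close>.\<close>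
    have *: "card X \<le> n" if "X \<subseteq> {1..n}" for X :: "nat set"
      using card_mono[OF _ that] by simp
    have eq: "{X. X \<in> Pow {1..n} \<and> n - card X = k} = {J. J \<subseteq> {1..n} \<and> card J = n - k}"
      using \<open>k \<in> {..n}\<close> * by (auto dest: *)
    have "(-1::real) ^ (n - k) = (-1) ^ (n + k)"
      using \<open>k \<in> {..n}\<close> by (simp add: minus_one_power_iff)
    then show "(\<Sum>X | X \<in> Pow {1..n} \<and> n - card X = k. (-1) ^ card X * prod y X * x ^ (n - card X))
        = (-1) ^ (n + k) * esym n k y * x ^ k"
      unfolding eq esym_def sum_distrib_left sum_distrib_right
      using \<open>k \<in> {..n}\<close> by (intro sum.cong) auto
  qed simp
  also have "\<dots> = x ^ n + (\<Sum>k<n. (-1) ^ (n + k) * esym n k y * x ^ k)"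
  proof -
    \<comment> \<open>The summand \<open>k = n\<close> comes from the empty set alone and is the
      leading term \<open>x ^ n\<close>.\<close>
    have "{J. J \<subseteq> {1..n} \<and> card J = 0} = {{}}"
      by (auto dest: finite_subset)
    then show ?thesis
      by (simp add: lessThan_Suc_atMost[symmetric] esym_def)
  qed
  finally show ?thesis .
qed

section \<open>Monotonicity from the sign of the derivative off a countable set\<close>

text \<open>Zygmund's argument: if \<open>h\<close> decreased, some value outside the countable set \<open>h ` C\<close> would have
  a last preimage, at which the derivative could not be positive.\<close>

lemma pos_deriv_countable_imp_le:
  fixes h :: "real \<Rightarrow> real"
  assumes "a \<le> b" and cont: "continuous_on {a..b} h" and "countable C"
    and der: "\<And>t. t \<in> {a<..<b} - C \<Longrightarrow> \<exists>D>0. (h has_real_derivative D) (at t)"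
  shows "h a \<le> h b"
proof (rule ccontr)
  assume "\<not> h a \<le> h b"
  then have "uncountable {h b<..<h a}" by (simp add: uncountable_open_interval)
  then have "\<not> {h b<..<h a} \<subseteq> h ` C"
    using \<open>countable C\<close> by (meson countable_image countable_subset)
  then obtain c where c: "h b < c" "c < h a" "c \<notin> h ` C"
    unfolding subset_iff greaterThanLessThan_iff by blast
  define T where "T = {a..b} \<inter> h -` {c..}"
  have "closed T"
    unfolding T_def by (rule continuous_closed_preimage[OF cont]) auto
  then have "compact T"
    unfolding T_def by (metis bounded_Int bounded_closed_interval compact_eq_bounded_closed)
  moreover have "a \<in> T" using c \<open>a \<le> b\<close> by (auto simp: T_def)
  ultimately obtain s where s: "s \<in> T" "\<And>t. t \<in> T \<Longrightarrow> t \<le> s"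
    using compact_attains_sup[of T] by auto
  have sb: "s < b" "a \<le> s" "c \<le> h s" using s c by (auto simp: T_def order_le_less)
  have right: "h t < c" if "s < t" "t \<le> b" for t
    using s(2)[of t] that sb by (force simp: T_def)
  have "\<exists>t\<ge>s. t \<le> b \<and> h t = c"
    using sb c by (intro IVT2') (auto intro: continuous_on_subset[OF cont])
  then have hs: "h s = c" using right by (metis less_irrefl order_le_less)
  then have "s \<in> {a<..<b} - C" using sb c by (auto simp: order_le_less)
  then obtain D where "D > 0" "(h has_real_derivative D) (at s)" using der by blast
  then obtain d where d: "d > 0" "\<And>e. 0 < e \<Longrightarrow> e < d \<Longrightarrow> h s < h (s + e)"
    using DERIV_pos_inc_right by blast
  define e where "e = min (d / 2) (b - s)"
  have "0 < e" "e < d" "s + e \<le> b" using d(1) sb by (auto simp: e_def)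
  with d(2)[of e] right[of "s + e"] hs show False by simp
qed

text \<open>Adding \<open>d * t\<close> with \<open>d > 0\<close> makes the derivative positive and
  reduces to the strict case, at a cost of \<open>d * (b - a)\<close>, which can be kept below any
  \<open>e > 0\<close>.\<close>

lemma nonneg_deriv_countable_imp_le:
  fixes h :: "real \<Rightarrow> real"
  assumes "a \<le> b" and cont: "continuous_on {a..b} h" and "countable C"
    and der: "\<And>t. t \<in> {a<..<b} - C \<Longrightarrow> \<exists>D\<ge>0. (h has_real_derivative D) (at t)"
  shows "h a \<le> h b"
proof (rule field_le_epsilon)
  fix e :: real assume "e > 0"
  \<comment> \<open>The \<open>+ 1\<close> keeps the denominator positive when
    \<open>a = b\<close>.\<close>
  define d where "d = e / (b - a + 1)"
  have "d > 0" using \<open>e > 0\<close> \<open>a \<le> b\<close> by (simp add: d_def)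
  have "h a + d * a \<le> h b + d * b"
  proof (rule pos_deriv_countable_imp_le[of a b "\<lambda>t. h t + d * t", OF \<open>a \<le> b\<close> _ \<open>countable C\<close>])
    show "continuous_on {a..b} (\<lambda>t. h t + d * t)"
      by (intro continuous_intros cont)
    fix t assume "t \<in> {a<..<b} - C"
    then obtain D where "D \<ge> 0" "(h has_real_derivative D) (at t)" using der by blast
    then show "\<exists>D>0. ((\<lambda>t. h t + d * t) has_real_derivative D) (at t)"
      using \<open>d > 0\<close> by (intro exI[of _ "D + d"]) (auto intro!: derivative_eq_intros)
  qed
  moreover have "d * (b - a) \<le> e"
    using \<open>e > 0\<close> \<open>a \<le> b\<close> by (simp add: d_def field_simps)
  ultimately show "h a \<le> h b + e" by (simp add: algebra_simps)
qed

section \<open>Velocities of the roots and of the coefficients\<close>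

lemma esym_has_derivative:
  fixes y :: "real \<Rightarrow> nat \<Rightarrow> real"
  assumes "\<And>i. i \<in> {1..n} \<Longrightarrow> ((\<lambda>s. y s i) has_real_derivative y' i) (at t)"
  shows "((\<lambda>s. esym n k (y s)) has_real_derivative
    (\<Sum>J | J \<subseteq> {1..n} \<and> card J = n - k. \<Sum>i\<in>J. y' i * (\<Prod>j\<in>J - {i}. y t j))) (at t)"
  unfolding esym_def
  by (intro DERIV_sum has_field_derivative_prod) (use assms in blast)

text \<open>Differentiating \<open>(\<Prod>i. x - y i) = x ^ n + \<dots>\<close> in \<open>t\<close> for fixed \<open>x\<close>, then setting \<open>x = y m\<close>.\<close>

lemma root_velocity:
  fixes y :: "real \<Rightarrow> nat \<Rightarrow> real"
  assumes y': "\<And>i. i \<in> {1..n} \<Longrightarrow> ((\<lambda>s. y s i) has_real_derivative y' i) (at t)"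
    and A': "\<And>k. k < n \<Longrightarrow> ((\<lambda>s. esym n k (y s)) has_real_derivative A' k) (at t)"
    and m: "m \<in> {1..n}"
  shows "y' m * (\<Prod>j\<in>{1..n} - {m}. y t m - y t j) =
    - (\<Sum>k<n. (-1) ^ (n + k) * A' k * y t m ^ k)"
proof -
  define x where "x = y t m"
  have "((\<lambda>s. \<Prod>i=1..n. x - y s i) has_real_derivative
      (\<Sum>i=1..n. (0 - y' i) * (\<Prod>j\<in>{1..n} - {i}. x - y t j))) (at t)"
    by (intro has_field_derivative_prod DERIV_diff DERIV_const y')
  moreover have "((\<lambda>s. \<Prod>i=1..n. x - y s i) has_real_derivative
      0 + (\<Sum>k<n. (-1) ^ (n + k) * A' k * x ^ k)) (at t)"
    unfolding prod_diff_esym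
    by (intro DERIV_add DERIV_const DERIV_sum DERIV_cmult DERIV_cmult_right A') simp
  ultimately have "(\<Sum>i=1..n. (0 - y' i) * (\<Prod>j\<in>{1..n} - {i}. x - y t j)) =
      (\<Sum>k<n. (-1) ^ (n + k) * A' k * x ^ k)"
    by (auto dest: DERIV_unique)
  \<comment> \<open>For \<open>i \<noteq> m\<close> the factor with \<open>j = m\<close> is
    \<open>x - y t m = 0\<close>, so only the velocity of the root \<open>m\<close>
    survives.\<close>
  moreover have "(\<Prod>j\<in>{1..n} - {i}. x - y t j) = 0" if "i \<in> {1..n} - {m}" for i
    using that m by (intro prod_zero) (auto simp: x_def)
  then have "(\<Sum>i=1..n. (0 - y' i) * (\<Prod>j\<in>{1..n} - {i}. x - y t j)) =
      - (y' m * (\<Prod>j\<in>{1..n} - {m}. x - y t j))"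
    using m by (subst sum.remove[of _ m]) (auto intro!: sum.neutral simp del: prod_zero_iff)
  ultimately show ?thesis
    unfolding x_def by linarith
qed

section \<open>The inequality along the path\<close>

theorem theorem2p3:
  fixes n :: nat and I :: "real set" and a b :: "nat \<Rightarrow> real"
    and S :: "nat set" and f :: "real \<Rightarrow> real"
  assumes "n \<ge> 2"
    and "open I" and "is_interval I"
    and "a \<in> Delta n I" and "b \<in> Delta n I"
    and "dominated n I a b"
    and "S = {k \<in> {0..n-1}. esym n k a < esym n k b}"
    and "Ck_on n f I"
    and "\<And>x k. x \<in> I \<Longrightarrow> k \<in> S \<Longrightarrow>
           (-1) ^ (n + k) * (deriv ^^ (n - 1)) (\<lambda>x. x ^ k * deriv f x) x \<le> 0"
  shows "(\<Sum>i=1..n. f (a i)) \<le> (\<Sum>i=1..n. f (b i))"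
proof -
  obtain y where yI: "\<And>t. t \<in> {0..1} \<Longrightarrow> y t \<in> Delta n I"
    and pw: "piecewise_diff n y" and y01: "y 0 = a" "y 1 = b"
    and ndist: "countable {t \<in> {0..1}. \<not> (\<forall>i\<in>{1..n}. \<forall>j\<in>{1..n}. i \<noteq> j \<longrightarrow> y t i \<noteq> y t j)}"
    and mono: "\<And>k. k \<in> {0..n-1} \<Longrightarrow> mono_on {0..1} (\<lambda>t. esym n k (y t))"
    using \<open>dominated n I a b\<close> unfolding dominated_def by blast
  have inI: "y t i \<in> I" if "t \<in> {0..1}" "i \<in> {1..n}" for t i
    using yI[OF that(1)] that(2) by (auto simp: Delta_def PiE_def Pi_def)
  have "diff_upto (Suc (n - 1)) f I"
    using \<open>Ck_on n f I\<close> \<open>n \<ge> 2\<close> by (simp add: Ck_on_def diff_upto_def)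
  then have f_diff: "\<And>x. x \<in> I \<Longrightarrow> (f has_real_derivative deriv f x) (at x)"
    and f'_diff: "diff_upto (n - 1) (deriv f) I"
    by (auto simp: diff_upto_Suc field_differentiable_derivI)
  \<comment> \<open>Times at which some root has no velocity, or at which two roots coincide and the
    divided differences lose their meaning.\<close>
  define C where "C =
    {t \<in> {0..1}. \<not> (\<forall>i\<in>{1..n}. (\<lambda>s. y s i) differentiable (at t within {0..1}))} \<union>
    {t \<in> {0..1}. \<not> (\<forall>i\<in>{1..n}. \<forall>j\<in>{1..n}. i \<noteq> j \<longrightarrow> y t i \<noteq> y t j)}"
  have "(\<Sum>i=1..n. f (y 0 i)) \<le> (\<Sum>i=1..n. f (y 1 i))"
  proof (rule nonneg_deriv_countable_imp_le[where C = C and h = "\<lambda>t. \<Sum>i=1..n. f (y t i)"])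
    show "countable C"
      using pw ndist by (simp add: C_def piecewise_diff_def)
    have f_cont: "continuous_on I f"
      using f_diff DERIV_isCont by (blast intro: continuous_at_imp_continuous_on)
    show "continuous_on {0..1} (\<lambda>t. \<Sum>i=1..n. f (y t i))"
    proof (rule continuous_on_sum)
      fix i assume "i \<in> {1..n}"
      then show "continuous_on {0..1} (\<lambda>t. f (y t i))"
        using pw inI
        by (intro continuous_on_compose2[OF f_cont]) (auto simp: piecewise_diff_def)
    qed
  next
    fix t :: real assume t: "t \<in> {0<..<1} - C"
    then have t01: "t \<in> {0..1}" and t_int: "t \<in> interior {0..1}" by auto
    have "\<exists>D. ((\<lambda>s. y s i) has_real_derivative D) (at t)" if "i \<in> {1..n}" for i
      using t t01 that at_within_interior[OF t_int]
      by (auto simp: C_def real_differentiable_def)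
    then have "\<forall>i\<in>{1..n}. \<exists>D. ((\<lambda>s. y s i) has_real_derivative D) (at t)"
      by blast
    from bchoice[OF this] obtain y'
      where y': "\<And>i. i \<in> {1..n} \<Longrightarrow> ((\<lambda>s. y s i) has_real_derivative y' i) (at t)"
      by blast
    have inj: "inj_on (y t) {1..n}"
      using t t01 unfolding C_def inj_on_def by blast
    obtain A' where A': "\<And>k. ((\<lambda>s. esym n k (y s)) has_real_derivative A' k) (at t)"
      by (rule that) (rule esym_has_derivative[OF y'])
    have A'_nonneg: "A' k \<ge> 0" if "k < n" for k
      using mono_on_imp_deriv_nonneg[OF mono A' t_int] that by simp
    have A'_zero: "A' k = 0" if "k < n" "k \<notin> S" for k
    proof -
      have k: "k \<in> {0..n-1}" using that by simp
      then have "esym n k (y 1) \<le> esym n k (y 0)"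
        using that by (simp add: y01 \<open>S = _\<close>)
      \<comment> \<open>Monotonicity squeezes the value at \<open>s\<close> between two equal end
        values.\<close>
      then have "esym n k (y s) = esym n k (y 0)" if "s \<in> {0<..<1}" for s
        using that monotone_onD[OF mono[OF k], of 0 s] monotone_onD[OF mono[OF k], of s 1] by auto
      then have "((\<lambda>s. esym n k (y s)) has_real_derivative 0) (at t)"
        using t by (intro has_field_derivative_transform_within_open
            [OF DERIV_const[of "esym n k (y 0)"], of "{0<..<1}"]) auto
      then show ?thesis using A' DERIV_unique by blast
    qed
    \<comment> \<open>\<open>w i\<close> is the derivative at \<open>y t i\<close> of the monic
      polynomial with roots \<open>y t j\<close>. With these denominators, \<open>dd k\<close> below
      is the divided difference of \<open>x ^ k * deriv f x\<close> at the \<open>n\<close> roots,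
      hence of order \<open>n - 1\<close>.\<close>
    define w where "w i = (\<Prod>j\<in>{1..n} - {i}. y t i - y t j)" for i
    define dd where "dd k = (\<Sum>i=1..n. y t i ^ k * deriv f (y t i) / w i)" for k
    have dd_sign: "(-1) ^ (n + k) * dd k \<le> 0" if "k \<in> S" for k
    proof -
      let ?G = "\<lambda>j. (deriv ^^ j) (\<lambda>x. x ^ k * deriv f x)"
      have "diff_upto (n - 1) (\<lambda>x. x ^ k * deriv f x) I"
        by (intro diff_upto_mult diff_upto_power f'_diff \<open>open I\<close>)
      then have der: "(?G j has_real_derivative ?G (Suc j) x) (at x)" if "j < n - 1" "x \<in> I" for j x
        using that by (auto simp: diff_upto_def field_differentiable_derivI)
      have "y t ` {1..n} \<subseteq> I" and "card {1..n} = Suc (n - 1)"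
        using inI[OF t01] \<open>n \<ge> 2\<close> by auto
      then obtain \<xi> where "\<xi> \<in> I" and \<xi>: "fact (n - 1) * dd k = ?G (n - 1) \<xi>"
        using divided_difference_mvt[OF \<open>is_interval I\<close>, of "n - 1" ?G "{1..n}" "y t", OF der]
          inj unfolding dd_def w_def funpow_0 by blast
      have "fact (n - 1) * ((-1) ^ (n + k) * dd k) = (-1) ^ (n + k) * ?G (n - 1) \<xi>"
        unfolding \<xi>[symmetric] by (simp only: mult_ac)
      also have "\<dots> \<le> 0" using assms(9) \<open>\<xi> \<in> I\<close> that by blast
      finally show ?thesis
        by (rule mult_left_le_imp_le[of "fact (n - 1)" _ 0, unfolded mult_zero_right]) simp
    qed
    have "y' i = - (\<Sum>k<n. (-1) ^ (n + k) * A' k * y t i ^ k) / w i" if i: "i \<in> {1..n}" for i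
    proof -
      have "y t i \<noteq> y t j" if "j \<in> {1..n} - {i}" for j
        using inj_onD[OF inj _ i, of j] that by auto
      then have "w i \<noteq> 0" by (simp add: w_def)
      moreover have "y' i * w i = - (\<Sum>k<n. (-1) ^ (n + k) * A' k * y t i ^ k)"
        unfolding w_def by (rule root_velocity[OF y' A' i])
      ultimately show ?thesis by (metis nonzero_mult_div_cancel_right)
    qed
    \<comment> \<open>Inserting the velocities and exchanging the sums collects the contribution of
      each coefficient into one \<open>dd k\<close>.\<close>
    then have "(\<Sum>i=1..n. deriv f (y t i) * y' i) =
        (\<Sum>i=1..n. \<Sum>k<n. - ((-1) ^ (n + k) * A' k * (y t i ^ k * deriv f (y t i) / w i)))"
      by (intro sum.cong) (simp_all add: sum_distrib_left sum_divide_distrib sum_negf mult_ac)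
    also have "\<dots> = (\<Sum>k<n. A' k * - ((-1) ^ (n + k) * dd k))"
      unfolding dd_def by (subst sum.swap) (simp add: sum_distrib_left sum_negf mult_ac)
    also have "\<dots> \<ge> 0"
    proof (rule sum_nonneg)
      fix k assume "k \<in> {..<n}"
      \<comment> \<open>For \<open>k \<in> S\<close> both factors are nonnegative; otherwise
        \<open>A' k = 0\<close>.\<close>
      then show "0 \<le> A' k * - ((-1) ^ (n + k) * dd k)"
        using A'_nonneg[of k] A'_zero[of k] dd_sign[of k]
        by (cases "k \<in> S") (auto intro: mult_nonneg_nonpos)
    qed
    finally have "0 \<le> (\<Sum>i=1..n. deriv f (y t i) * y' i)" .
    moreover have "((\<lambda>s. \<Sum>i=1..n. f (y s i)) has_real_derivative
        (\<Sum>i=1..n. deriv f (y t i) * y' i)) (at t)"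
      by (intro DERIV_sum DERIV_chain2[where f = f] f_diff y' inI[OF t01])
    ultimately show "\<exists>D\<ge>0. ((\<lambda>s. \<Sum>i=1..n. f (y s i)) has_real_derivative D) (at t)"
      by blast
  qed simp
  then show ?thesis by (simp add: y01)
qed

end
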